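(* The $D_6$-action on the Racah algebra $\Re$ is faithful.
   Context: $\mathbb F$ is a field with $\operatorname{char}\mathbb F\neq 2$. All algebras are unital and associative. Write $[x,y]=xy-yx$. The Racah algebra $\Re$ is the $\mathbb F$-algebra defined by generators $A,B,C,D$ and the relations $[A,B]=[B,C]=[C,A]=2D$ together with the relations asserting that each of the elements $$\alpha=[A,D]+AC-BA,\qquad \beta=[B,D]+BA-CB,\qquad \gamma=[C,D]+CB-AC$$ is central in $\Re$. Set $\delta=A+B+C$. $D_6$ is the dihedral group with generators $\sigma,\tau$ and relations $\sigma^2=1$, $\tau^6=1$, $(\sigma\tau)^2=1$. The $D_6$-action on $\Re$ is the unique one for which $\sigma$ and $\tau$ act as $\mathbb F$-algebra antiautomorphisms with: $\sigma$ sends $A,B,C,D,\alpha,\beta,\gamma,\delta$ to $B,A,C,D,-\beta,-\alpha,-\gamma,\delta$ respectively, and $\tau$ sends $A,B,C,D,\alpha,\beta,\gamma,\delta$ to $B,C,A,-D,\beta,\gamma,\alpha,\delta$ respectively. *)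

theory Defs
  imports
    "HOL-Library.Poly_Mapping"
    "HOL-Computational_Algebra.Computational_Algebra"
    "HOL-Algebra.Group_Action"
    "HOL-Algebra.QuotRing"
    "HOL-Algebra.Module"
begin

section \<open>Free algebras\<close>

text \<open>
  The free unital associative algebra on generators \<open>'g\<close> over \<open>'k\<close> is the monoid algebra of the free
  monoid on \<open>'g\<close>. The monoid is written additively because the convolution product of
  \<^theory>\<open>HOL-Library.Poly_Mapping\<close> is.
\<close>

datatype 'g word = Word (letters: "'g list")

instantiation word :: (type) monoid_add
begin
definition zero_word :: "'a word" where "0 = Word []"
definition plus_word :: "'a word \<Rightarrow> 'a word \<Rightarrow> 'a word"
  where "u + v = Word (letters u @ letters v)"
instance by standard (auto simp: zero_word_def plus_word_def)
end

type_synonym ('g, 'k) free_algebra = "'g word \<Rightarrow>\<^sub>0 'k"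

definition fgen :: "'g \<Rightarrow> ('g, 'k::field) free_algebra"
  where "fgen g = Poly_Mapping.single (Word [g]) 1"

definition fscalar :: "'k::field \<Rightarrow> ('g, 'k) free_algebra"
  where "fscalar c = Poly_Mapping.single 0 c"

definition free_ring :: "('g, 'k::field) free_algebra ring"
  where "free_ring = \<lparr>carrier = UNIV, mult = (*), one = 1, zero = 0, add = (+)\<rparr>"

definition commutator :: "'a::ring_1 \<Rightarrow> 'a \<Rightarrow> 'a"
  where "commutator x y = x * y - y * x"

text \<open>
  The algebra with generators \<open>'g\<close> and relations \<open>r = 0\<close> for \<open>r \<in> R\<close>. The record type of modules is
  used to keep the scalar multiplication together with the ring structure.
\<close>

definition relator_ideal :: "('g, 'k::field) free_algebra set \<Rightarrow> ('g, 'k) free_algebra set"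
  where "relator_ideal R = Idl\<^bsub>free_ring\<^esub> R"

definition residue_class ::
    "('g, 'k::field) free_algebra set \<Rightarrow> ('g, 'k) free_algebra \<Rightarrow> ('g, 'k) free_algebra set"
  where "residue_class R x = relator_ideal R +>\<^bsub>free_ring\<^esub> x"

definition presented_algebra ::
    "('g, 'k::field) free_algebra set \<Rightarrow> ('k, ('g, 'k) free_algebra set) module"
  where "presented_algebra R =
    ring.extend (free_ring Quot relator_ideal R)
      (module.fields (\<lambda>c X. residue_class R (fscalar c) \<otimes>\<^bsub>free_ring Quot relator_ideal R\<^esub> X))"

definition algebra_antiautomorphism :: "('k, 'a) module \<Rightarrow> ('a \<Rightarrow> 'a) \<Rightarrow> bool"
  where "algebra_antiautomorphism M f \<longleftrightarrow>
    bij_betw f (carrier M) (carrier M) \<and>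
    (\<forall>x\<in>carrier M. \<forall>y\<in>carrier M. f (x \<oplus>\<^bsub>M\<^esub> y) = f x \<oplus>\<^bsub>M\<^esub> f y) \<and>
    (\<forall>c. \<forall>x\<in>carrier M. f (c \<odot>\<^bsub>M\<^esub> x) = c \<odot>\<^bsub>M\<^esub> f x) \<and>
    f \<one>\<^bsub>M\<^esub> = \<one>\<^bsub>M\<^esub> \<and>
    (\<forall>x\<in>carrier M. \<forall>y\<in>carrier M. f (x \<otimes>\<^bsub>M\<^esub> y) = f y \<otimes>\<^bsub>M\<^esub> f x)"


section \<open>The Racah algebra\<close>

datatype racah_gen = GA | GB | GC | GD

abbreviation fA :: "(racah_gen, 'k::field) free_algebra" where "fA \<equiv> fgen GA"
abbreviation fB :: "(racah_gen, 'k::field) free_algebra" where "fB \<equiv> fgen GB"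
abbreviation fC :: "(racah_gen, 'k::field) free_algebra" where "fC \<equiv> fgen GC"
abbreviation fD :: "(racah_gen, 'k::field) free_algebra" where "fD \<equiv> fgen GD"

definition falpha :: "(racah_gen, 'k::field) free_algebra"
  where "falpha = commutator fA fD + fA * fC - fB * fA"
definition fbeta :: "(racah_gen, 'k::field) free_algebra"
  where "fbeta = commutator fB fD + fB * fA - fC * fB"
definition fgamma :: "(racah_gen, 'k::field) free_algebra"
  where "fgamma = commutator fC fD + fC * fB - fA * fC"
definition fdelta :: "(racah_gen, 'k::field) free_algebra"
  where "fdelta = fA + fB + fC"

definition racah_relators :: "(racah_gen, 'k::field) free_algebra set"
  where "racah_relators =
    {commutator fA fB - 2 * fD, commutator fB fC - 2 * fD, commutator fC fA - 2 * fD} \<union>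
    {commutator z x | z x. z \<in> {falpha, fbeta, fgamma}}"

definition racah :: "('k::field, (racah_gen, 'k) free_algebra set) module"
  where "racah = presented_algebra racah_relators"

abbreviation racah_class ::
    "(racah_gen, 'k::field) free_algebra \<Rightarrow> (racah_gen, 'k) free_algebra set"
  where "racah_class \<equiv> residue_class racah_relators"

definition rA :: "(racah_gen, 'k::field) free_algebra set" where "rA = racah_class fA"
definition rB :: "(racah_gen, 'k::field) free_algebra set" where "rB = racah_class fB"
definition rC :: "(racah_gen, 'k::field) free_algebra set" where "rC = racah_class fC"
definition rD :: "(racah_gen, 'k::field) free_algebra set" where "rD = racah_class fD"
definition ralpha :: "(racah_gen, 'k::field) free_algebra set" where "ralpha = racah_class falpha"
definition rbeta :: "(racah_gen, 'k::field) free_algebra set" where "rbeta = racah_class fbeta"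
definition rgamma :: "(racah_gen, 'k::field) free_algebra set" where "rgamma = racah_class fgamma"
definition rdelta :: "(racah_gen, 'k::field) free_algebra set" where "rdelta = racah_class fdelta"


section \<open>The dihedral group\<close>

text \<open>
  Groups given by generators \<open>'g\<close> and relations \<open>r = 1\<close> for \<open>r \<in> R\<close>. The pair \<open>(g, True)\<close> stands for
  the generator \<open>g\<close> and \<open>(g, False)\<close> for its inverse.
\<close>

type_synonym 'g group_word = "('g \<times> bool) list"

inductive word_equiv :: "'g group_word set \<Rightarrow> 'g group_word \<Rightarrow> 'g group_word \<Rightarrow> bool"
  for R :: "'g group_word set" where
  refl: "word_equiv R u u"
| sym: "word_equiv R u v \<Longrightarrow> word_equiv R v u"
| trans: "word_equiv R u v \<Longrightarrow> word_equiv R v w \<Longrightarrow> word_equiv R u w"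
| append: "word_equiv R u u' \<Longrightarrow> word_equiv R v v' \<Longrightarrow> word_equiv R (u @ v) (u' @ v')"
| cancel: "word_equiv R [(g, b), (g, \<not> b)] []"
| relator: "r \<in> R \<Longrightarrow> word_equiv R r []"

definition word_class :: "'g group_word set \<Rightarrow> 'g group_word \<Rightarrow> 'g group_word set"
  where "word_class R u = {v. word_equiv R u v}"

definition presented_group :: "'g group_word set \<Rightarrow> 'g group_word set monoid"
  where "presented_group R =
    \<lparr>carrier = range (word_class R),
     mult = (\<lambda>X Y. \<Union>u\<in>X. \<Union>v\<in>Y. word_class R (u @ v)),
     one = word_class R []\<rparr>"

datatype dihedral_gen = Sigma | Tau

definition d6_relators :: "dihedral_gen group_word set"
  where "d6_relators =
    {replicate 2 (Sigma, True), replicate 6 (Tau, True),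
     concat (replicate 2 [(Sigma, True), (Tau, True)])}"

definition D6 :: "dihedral_gen group_word set monoid"
  where "D6 = presented_group d6_relators"

definition d6_sigma :: "dihedral_gen group_word set"
  where "d6_sigma = word_class d6_relators [(Sigma, True)]"

definition d6_tau :: "dihedral_gen group_word set"
  where "d6_tau = word_class d6_relators [(Tau, True)]"


section \<open>The action of the dihedral group on the Racah algebra\<close>

text \<open>
  \<open>D6\<close> acts by bijections of the underlying set (the generators act by antiautomorphisms, so not every
  element acts by algebra automorphisms). Extensionality makes the action unique as a function of
  HOL, without restricting its values on \<open>D6\<close>.
\<close>

definition is_racah_D6_action ::
    "(dihedral_gen group_word set \<Rightarrow>
      (racah_gen, 'k::field) free_algebra set \<Rightarrow> (racah_gen, 'k) free_algebra set) \<Rightarrow> bool"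
  where "is_racah_D6_action \<phi> \<longleftrightarrow>
    group_action D6 (carrier racah) \<phi> \<and> \<phi> \<in> extensional (carrier D6) \<and>
    algebra_antiautomorphism racah (\<phi> d6_sigma) \<and>
    \<phi> d6_sigma rA = rB \<and> \<phi> d6_sigma rB = rA \<and> \<phi> d6_sigma rC = rC \<and> \<phi> d6_sigma rD = rD \<and>
    \<phi> d6_sigma ralpha = \<ominus>\<^bsub>racah\<^esub> rbeta \<and> \<phi> d6_sigma rbeta = \<ominus>\<^bsub>racah\<^esub> ralpha \<and>
    \<phi> d6_sigma rgamma = \<ominus>\<^bsub>racah\<^esub> rgamma \<and> \<phi> d6_sigma rdelta = rdelta \<and>
    algebra_antiautomorphism racah (\<phi> d6_tau) \<and>
    \<phi> d6_tau rA = rB \<and> \<phi> d6_tau rB = rC \<and> \<phi> d6_tau rC = rA \<and> \<phi> d6_tau rD = \<ominus>\<^bsub>racah\<^esub> rD \<and>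
    \<phi> d6_tau ralpha = rbeta \<and> \<phi> d6_tau rbeta = rgamma \<and>
    \<phi> d6_tau rgamma = ralpha \<and> \<phi> d6_tau rdelta = rdelta"

definition racah_D6_action ::
    "dihedral_gen group_word set \<Rightarrow>
      (racah_gen, 'k::field) free_algebra set \<Rightarrow> (racah_gen, 'k) free_algebra set"
  where "racah_D6_action = (THE \<phi>. is_racah_D6_action \<phi>)"


section \<open>Existence and uniqueness of the action\<close>

subsection \<open>Antihomomorphisms of free algebras\<close>

lemma fa_induct [case_names single plus]:
  fixes p :: "('g,'k::field) free_algebra"
  assumes s: "\<And>w c. P (Poly_Mapping.single w c)" and a: "\<And>p q. P p \<Longrightarrow> P q \<Longrightarrow> P (p + q)"
  shows "P p"
proof (induction p rule: update_induct)
  case const then show ?case using s[of 0 0] by simp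
next
  case (update f w c)
  have "Poly_Mapping.update w c f = Poly_Mapping.single w c + f"
    using update by (intro poly_mapping_eqI) 
      (auto simp: lookup_update lookup_add lookup_single not_in_keys_iff_lookup_eq_zero when_def)
  then show ?case using update s a by auto
qed

lemma fscalar_comm: "fscalar c * p = p * fscalar (c::'k::field)"
  by (induction p rule: fa_induct) (auto simp: fscalar_def mult_single algebra_simps)

lemma single_Cons: "Poly_Mapping.single (Word (g # gs)) c = fgen g * Poly_Mapping.single (Word gs) (c::'k::field)"
  by (simp add: fgen_def mult_single plus_word_def)

lemma fa_gen_induct [case_names scalar gen plus mult]:
  fixes p :: "('g,'k::field) free_algebra"
  assumes s: "\<And>c. P (fscalar c)" and g: "\<And>g. P (fgen g)" and a: "\<And>p q. P p \<Longrightarrow> P q \<Longrightarrow> P (p + q)"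
    and m: "\<And>p q. P p \<Longrightarrow> P q \<Longrightarrow> P (p * q)"
  shows "P p"
proof (induction p rule: fa_induct)
  case (single w c)
  obtain gs where w: "w = Word gs" by (cases w)
  show ?case unfolding w
  proof (induction gs)
    case Nil show ?case using s[of c] by (simp add: fscalar_def zero_word_def)
  next
    case (Cons x xs) then show ?case using g m by (simp add: single_Cons)
  qed
qed (rule a)

definition fprod :: "('g \<Rightarrow> ('g,'k::field) free_algebra) \<Rightarrow> 'g word \<Rightarrow> ('g,'k) free_algebra" where
  "fprod h w = prod_list (rev (map h (letters w)))"

definition anti_extension :: "('g \<Rightarrow> ('g,'k::field) free_algebra) \<Rightarrow> ('g,'k) free_algebra \<Rightarrow> ('g,'k) free_algebra" where
  "anti_extension h p = (\<Sum>w\<in>Poly_Mapping.keys p. fscalar (Poly_Mapping.lookup p w) * fprod h w)"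

lemma fscalar_simps: "fscalar 0 = 0" "fscalar 1 = 1" "fscalar (a+b) = fscalar a + fscalar b"
  "fscalar (a*b) = fscalar a * fscalar (b::'k::field)"
  by (auto simp: fscalar_def single_add mult_single)

lemma aext_super: "finite S \<Longrightarrow> Poly_Mapping.keys p \<subseteq> S \<Longrightarrow> anti_extension h p = (\<Sum>w\<in>S. fscalar (Poly_Mapping.lookup p w) * fprod h w)"
  unfolding anti_extension_def by (rule sum.mono_neutral_left) (auto simp: not_in_keys_iff_lookup_eq_zero fscalar_simps)

lemma aext_add: "anti_extension h (p + q) = anti_extension h p + anti_extension h q"
proof -
  let ?S = "Poly_Mapping.keys p \<union> Poly_Mapping.keys q"
  have "anti_extension h (p+q) = (\<Sum>w\<in>?S. fscalar (Poly_Mapping.lookup (p+q) w) * fprod h w)"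
    by (rule aext_super) (auto simp: keys_add)
  also have "\<dots> = anti_extension h p + anti_extension h q"
    by (subst (1 2) aext_super[where S="?S"]) (auto simp: lookup_add fscalar_simps algebra_simps sum.distrib)
  finally show ?thesis .
qed

lemma aext_single: "anti_extension h (Poly_Mapping.single w c) = fscalar c * fprod h w"
  by (subst aext_super[where S="{w}"]) auto

lemma fprod_add: "fprod h (u + v) = fprod h v * fprod h u"
  by (simp add: fprod_def plus_word_def)

lemma aext_mult: "anti_extension h (p * q) = anti_extension h q * anti_extension h p"
proof (induction p rule: fa_induct)
  case (single w c)
  show ?case
  proof (induction q rule: fa_induct)
    case (single v d)
    have "fscalar (c * d) * (fprod h v * fprod h w) = fscalar d * (fscalar c * fprod h v) * fprod h w"
      by (simp only: mult.commute[of c d] fscalar_simps mult.assoc)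
    also have "\<dots> = fscalar d * fprod h v * (fscalar c * fprod h w)"
      by (simp only: fscalar_comm[of c "fprod h v"] mult.assoc)
    finally show ?case by (simp add: mult_single aext_single fprod_add)
  qed (simp add: aext_add algebra_simps)
qed (simp add: aext_add algebra_simps)

lemma aext_scalar: "anti_extension h (fscalar c) = fscalar c"
  unfolding fscalar_def aext_single by (simp add: fprod_def zero_word_def fscalar_def[symmetric])
lemma aext_gen: "anti_extension h (fgen g) = h g"
  unfolding fgen_def aext_single by (simp add: fprod_def fscalar_simps)

definition is_antihom where "is_antihom f \<longleftrightarrow> (\<forall>c. f (fscalar c) = fscalar c) \<and> (\<forall>p q. f (p+q) = f p + f q) \<and> (\<forall>p q. f (p*q) = f q * f p)"
definition is_hom where "is_hom f \<longleftrightarrow> (\<forall>c. f (fscalar c) = fscalar c) \<and> (\<forall>p q. f (p+q) = f p + f q) \<and> (\<forall>p q. f (p*q) = f p * f q)"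

lemma fanti_aext: "is_antihom (anti_extension h)" by (simp add: is_antihom_def aext_add aext_mult aext_scalar)

lemma fanti_simps: assumes "is_antihom f" 
  shows "f (fscalar c) = fscalar c" "f (p+q) = f p + f q" "f (p*q) = f q * f p" "f 1 = 1" "f 0 = 0"
   "f (-p) = - f p" "f (p - q) = f p - f q" "f (numeral n) = numeral n"
proof -
  show 1: "f (fscalar c) = fscalar c" "f (p+q) = f p + f q" "f (p*q) = f q * f p"  for p q c
    using assms by (auto simp: is_antihom_def)
  have n: "fscalar (numeral n) = numeral n" by (simp add: fscalar_def)
  show "f 1 = 1" using 1(1)[of 1] by (simp only: fscalar_simps)
  show 0: "f 0 = 0" using 1(1)[of 0] by (simp only: fscalar_simps)
  show "f (numeral n) = numeral n" using 1(1)[of "numeral n"] by (simp only: n)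
  show m: "f (-p) = - f p" for p
  proof -
    have "f p + f (-p) = 0" using 1(2)[of p "-p"] 0 by simp
    then show ?thesis by (rule minus_unique[symmetric])
  qed
  show "f (p - q) = f p - f q" using 1(2)[of p "-q"] m by simp
qed

lemma fanti_comp: "is_antihom f \<Longrightarrow> is_antihom g \<Longrightarrow> is_hom (f \<circ> g)" "is_antihom f \<Longrightarrow> is_hom g \<Longrightarrow> is_antihom (f \<circ> g)" 
  "is_hom f \<Longrightarrow> is_antihom g \<Longrightarrow> is_antihom (f \<circ> g)" "is_hom f \<Longrightarrow> is_hom g \<Longrightarrow> is_hom (f \<circ> g)"
  by (auto simp: is_antihom_def is_hom_def)

lemma fhom_id: "is_hom f \<Longrightarrow> (\<And>g. f (fgen g) = fgen g) \<Longrightarrow> f = id"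
proof
  fix p assume "is_hom f" "\<And>g. f (fgen g) = fgen g" then show "f p = id p"
    by (induction p rule: fa_gen_induct) (auto simp: is_hom_def)
qed

subsection \<open>Presented algebras\<close>

lemma free_ring_simps: "carrier free_ring = UNIV" "mult free_ring = (*)" "one free_ring = 1" "zero free_ring = 0"
  "add free_ring = (+)" by (auto simp: free_ring_def)

lemma free_ring: "ring free_ring"
proof (rule ringI)
  show "abelian_group (free_ring :: ('g,'k::field) free_algebra ring)"
  proof (rule abelian_groupI)
    fix x :: "('g,'k::field) free_algebra"
    show "\<exists>y\<in>carrier free_ring. y \<oplus>\<^bsub>free_ring\<^esub> x = \<zero>\<^bsub>free_ring\<^esub>"
      by (auto simp: free_ring_simps intro: exI[of _ "-x"])
  qed (auto simp: free_ring_simps algebra_simps)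
  show "Group.monoid free_ring" by (rule monoidI) (auto simp: free_ring_simps algebra_simps)
qed (auto simp: free_ring_simps algebra_simps)

lemma free_ring_uminus:
  fixes x :: "('g,'k::field) free_algebra"
  shows "\<ominus>\<^bsub>free_ring\<^esub> x = - x"
proof -
  interpret ring "free_ring :: ('g,'k::field) free_algebra ring" by (rule free_ring)
  show ?thesis by (rule minus_equality) (auto simp: free_ring_simps)
qed

lemma ideal_rel: "ideal (relator_ideal R) free_ring"
  unfolding relator_ideal_def by (rule ring.genideal_ideal[OF free_ring]) (simp add: free_ring_simps)

lemma rel_ideal_simps:
  "r \<in> R \<Longrightarrow> r \<in> relator_ideal R" "0 \<in> relator_ideal R"
  "a \<in> relator_ideal R \<Longrightarrow> b \<in> relator_ideal R \<Longrightarrow> a + b \<in> relator_ideal R"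
  "a \<in> relator_ideal R \<Longrightarrow> - a \<in> relator_ideal R"
  "a \<in> relator_ideal R \<Longrightarrow> b \<in> relator_ideal R \<Longrightarrow> a - b \<in> relator_ideal R"
  "a \<in> relator_ideal R \<Longrightarrow> x * a \<in> relator_ideal R" "a \<in> relator_ideal R \<Longrightarrow> a * x \<in> relator_ideal R"
proof -
  interpret ideal "relator_ideal R" free_ring by (rule ideal_rel)
  show "r \<in> R \<Longrightarrow> r \<in> relator_ideal R" by (auto simp: relator_ideal_def genideal_def)
  show "0 \<in> relator_ideal R" using additive_subgroup.zero_closed[OF additive_subgroup_axioms] by (simp add: free_ring_simps)
  show *: "a \<in> relator_ideal R \<Longrightarrow> b \<in> relator_ideal R \<Longrightarrow> a + b \<in> relator_ideal R" for a b
    using additive_subgroup.a_closed[OF additive_subgroup_axioms, of a b] by (simp add: free_ring_simps)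
  show **: "a \<in> relator_ideal R \<Longrightarrow> - a \<in> relator_ideal R" for a
    using I_l_closed[of a "-1"] by (simp add: free_ring_simps)
  show "a \<in> relator_ideal R \<Longrightarrow> b \<in> relator_ideal R \<Longrightarrow> a - b \<in> relator_ideal R" using *[of a "-b"] ** by simp
  show "a \<in> relator_ideal R \<Longrightarrow> x * a \<in> relator_ideal R" "a \<in> relator_ideal R \<Longrightarrow> a * x \<in> relator_ideal R"
    using I_l_closed[of a x] I_r_closed[of a x] by (auto simp: free_ring_simps)
qed

lemma rel_ideal_least: 
  fixes J :: "('g,'k::field) free_algebra set"
  assumes "R \<subseteq> J" "0 \<in> J" "\<And>a b. a \<in> J \<Longrightarrow> b \<in> J \<Longrightarrow> a + b \<in> J" "\<And>a. a \<in> J \<Longrightarrow> -a \<in> J"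
   "\<And>a x. a \<in> J \<Longrightarrow> x * a \<in> J" "\<And>a x. a \<in> J \<Longrightarrow> a * x \<in> J"
 shows "relator_ideal R \<subseteq> J"
proof -
  have "ideal J free_ring"
  proof (rule idealI[OF free_ring])
    interpret r: ring "free_ring :: ('g,'k::field) free_algebra ring" by (rule free_ring)
    have e: "inv\<^bsub>\<lparr>carrier = UNIV, monoid.mult = (+), one = 0\<rparr>\<^esub> a = - a" for a :: "('g,'k::field) free_algebra"
      using free_ring_uminus[of a] by (simp add: a_inv_def free_ring_simps)
    show "subgroup J (add_monoid free_ring)"
      by (rule group.subgroupI[OF r.a_group]) (use assms in \<open>auto simp: free_ring_simps e\<close>)
  qed (use assms in \<open>auto simp: free_ring_simps\<close>)
  then show ?thesis using assms(1) unfolding relator_ideal_def genideal_def by auto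
qed

lemma rc_def': "residue_class R x = {y. y - x \<in> relator_ideal R}"
  by (auto simp: residue_class_def a_r_coset_def' free_ring_simps)

lemma rc_eq: "residue_class R x = residue_class R y \<longleftrightarrow> x - y \<in> relator_ideal R"
proof
  assume "residue_class R x = residue_class R y"
  moreover have "x \<in> residue_class R x" unfolding rc_def' using rel_ideal_simps(2) by simp
  ultimately show "x - y \<in> relator_ideal R" by (simp add: rc_def')
next
  assume *: "x - y \<in> relator_ideal R"
  have "z - x \<in> relator_ideal R \<longleftrightarrow> z - y \<in> relator_ideal R" for z
    using rel_ideal_simps(3)[of "z - x" R "x - y"] rel_ideal_simps(5)[of "z - y" R "x - y"] * by auto
  then show "residue_class R x = residue_class R y" by (simp add: rc_def')
qed

lemma pa_simps:
  "carrier (presented_algebra R) = range (residue_class R)"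
  "residue_class R x \<otimes>\<^bsub>presented_algebra R\<^esub> residue_class R y = residue_class R (x * y)"
  "residue_class R x \<oplus>\<^bsub>presented_algebra R\<^esub> residue_class R y = residue_class R (x + y)"
  "\<one>\<^bsub>presented_algebra R\<^esub> = residue_class R 1"
  "\<zero>\<^bsub>presented_algebra R\<^esub> = residue_class R 0"
  "c \<odot>\<^bsub>presented_algebra R\<^esub> residue_class R x = residue_class R (fscalar c * x)"
proof -
  interpret ideal "relator_ideal R" free_ring by (rule ideal_rel)
  have m: "rcoset_mult free_ring (relator_ideal R) (residue_class R x) (residue_class R y) = residue_class R (x * y)" for x y
    using rcoset_mult_add[of x y] by (simp add: free_ring_simps residue_class_def)
  show "carrier (presented_algebra R) = range (residue_class R)"
    by (auto simp: presented_algebra_def ring.defs FactRing_def A_RCOSETS_def' residue_class_def free_ring_simps)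
  show "residue_class R x \<otimes>\<^bsub>presented_algebra R\<^esub> residue_class R y = residue_class R (x * y)"
    using m by (simp add: presented_algebra_def ring.defs FactRing_def)
  show "residue_class R x \<oplus>\<^bsub>presented_algebra R\<^esub> residue_class R y = residue_class R (x + y)"
    using a_rcos_sum[of x y] by (simp add: presented_algebra_def ring.defs FactRing_def free_ring_simps residue_class_def)
  show "\<one>\<^bsub>presented_algebra R\<^esub> = residue_class R 1"
    by (simp add: presented_algebra_def ring.defs FactRing_def free_ring_simps residue_class_def)
  show "\<zero>\<^bsub>presented_algebra R\<^esub> = residue_class R 0"
    by (simp add: presented_algebra_def ring.defs FactRing_def rc_def')
  show "c \<odot>\<^bsub>presented_algebra R\<^esub> residue_class R x = residue_class R (fscalar c * x)"
    using m by (simp add: presented_algebra_def ring.defs module.defs FactRing_def)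
qed

lemma pa_ring: "ring (presented_algebra R)"
proof (rule ringI)
  show "abelian_group (presented_algebra R)"
  proof (rule abelian_groupI; (clarsimp simp: pa_simps algebra_simps)?)
    fix x show "\<exists>y. residue_class R (x + y) = residue_class R 0" by (rule exI[of _ "-x"]) simp
  qed
  show "Group.monoid (presented_algebra R)" by (rule monoidI) (auto simp: pa_simps algebra_simps)
qed (auto simp: pa_simps algebra_simps)

lemma pa_uminus: "\<ominus>\<^bsub>presented_algebra R\<^esub> residue_class R x = residue_class R (- x)"
proof -
  interpret ring "presented_algebra R" by (rule pa_ring)
  show ?thesis by (rule minus_equality) (auto simp: pa_simps)
qed

subsection \<open>Presented groups\<close>

lemma wc_eq: "word_class R u = word_class R v \<longleftrightarrow> word_equiv R u v"
  unfolding word_class_def using word_equiv.refl[of R] word_equiv.sym[of R] word_equiv.trans[of R] by blast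
   
lemma pg_simps:
  "carrier (presented_group R) = range (word_class R)"
  "word_class R u \<otimes>\<^bsub>presented_group R\<^esub> word_class R v = word_class R (u @ v)"
  "\<one>\<^bsub>presented_group R\<^esub> = word_class R []"
proof -
  show "carrier (presented_group R) = range (word_class R)" "\<one>\<^bsub>presented_group R\<^esub> = word_class R []"
    by (auto simp: presented_group_def)
  have "word_class R (u' @ v') = word_class R (u @ v)" if "u' \<in> word_class R u" "v' \<in> word_class R v" for u' v'
    using that unfolding wc_eq by (simp add: word_class_def word_equiv.append word_equiv.sym)
  moreover have "u \<in> word_class R u" "v \<in> word_class R v" by (auto simp: word_class_def word_equiv.refl)
  ultimately have "(\<Union>u'\<in>word_class R u. \<Union>v'\<in>word_class R v. word_class R (u' @ v')) = word_class R (u @ v)" by blast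
  then show "word_class R u \<otimes>\<^bsub>presented_group R\<^esub> word_class R v = word_class R (u @ v)"
    by (simp add: presented_group_def)
qed

definition word_inverse :: "'g group_word \<Rightarrow> 'g group_word" where "word_inverse u = rev (map (\<lambda>(g,b). (g, \<not> b)) u)"

lemma word_inverse: "word_equiv R (word_inverse u @ u) []"
proof (induction u)
  case Nil then show ?case by (simp add: word_inverse_def word_equiv.refl)
next
  case (Cons a u)
  obtain g b where a: "a = (g,b)" by (cases a)
  have "word_equiv R [(g, \<not> b), (g,b)] []" using word_equiv.cancel[of R g "\<not> b"] by simp
  then have "word_equiv R (word_inverse u @ [(g, \<not> b), (g,b)] @ u) (word_inverse u @ [] @ u)"
    by (intro word_equiv.append word_equiv.refl)
  then have "word_equiv R (word_inverse (a # u) @ a # u) (word_inverse u @ u)" by (simp add: a word_inverse_def)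
  then show ?case using Cons by (rule word_equiv.trans)
qed

lemma pg_group: "group (presented_group R)"
proof (rule groupI)
  fix x assume "x \<in> carrier (presented_group R)"
  then obtain u where "x = word_class R u" by (auto simp: pg_simps)
  then show "\<exists>y\<in>carrier (presented_group R). y \<otimes>\<^bsub>presented_group R\<^esub> x = \<one>\<^bsub>presented_group R\<^esub>"
    using word_inverse[of R u] by (auto simp: pg_simps wc_eq intro!: exI[of _ "word_inverse u"])
qed (auto simp: pg_simps)

subsection \<open>Lifting to the free algebra\<close>

definition racah_sg :: "(racah_gen,'k::field) free_algebra \<Rightarrow> (racah_gen,'k::field) free_algebra" where
 "racah_sg = anti_extension (\<lambda>g. case g of GA \<Rightarrow> fB | GB \<Rightarrow> fA | GC \<Rightarrow> fC | GD \<Rightarrow> fD)"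
definition racah_ta :: "(racah_gen,'k::field) free_algebra \<Rightarrow> (racah_gen,'k::field) free_algebra" where
 "racah_ta = anti_extension (\<lambda>g. case g of GA \<Rightarrow> fB | GB \<Rightarrow> fC | GC \<Rightarrow> fA | GD \<Rightarrow> - fD)"

lemma fanti_sg: "is_antihom racah_sg" and fanti_ta: "is_antihom racah_ta" by (auto simp: racah_sg_def racah_ta_def fanti_aext)
lemmas sg_simps = fanti_simps[OF fanti_sg]
lemmas ta_simps = fanti_simps[OF fanti_ta]
lemma sg_gen: "racah_sg fA = fB" "racah_sg fB = fA" "racah_sg fC = fC" "racah_sg fD = fD" by (auto simp: racah_sg_def aext_gen)
lemma ta_gen: "racah_ta fA = fB" "racah_ta fB = fC" "racah_ta fC = fA" "racah_ta fD = - fD" by (auto simp: racah_ta_def aext_gen)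

lemma sg2: "racah_sg \<circ> racah_sg = id"
proof (rule fhom_id[OF fanti_comp(1)[OF fanti_sg fanti_sg]])
  show "(racah_sg \<circ> racah_sg) (fgen g) = fgen g" for g by (cases g) (simp_all add: sg_gen)
qed
lemma ta6: "racah_ta \<circ> racah_ta \<circ> racah_ta \<circ> racah_ta \<circ> racah_ta \<circ> racah_ta = id"
proof (rule fhom_id)
  have "is_hom ((racah_ta \<circ> racah_ta) \<circ> ((racah_ta \<circ> racah_ta) \<circ> (racah_ta \<circ> racah_ta)))" by (intro fanti_comp fanti_ta)
  then show "is_hom (racah_ta \<circ> racah_ta \<circ> racah_ta \<circ> racah_ta \<circ> racah_ta \<circ> racah_ta)" by (simp add: comp_assoc)
  show "(racah_ta \<circ> racah_ta \<circ> racah_ta \<circ> racah_ta \<circ> racah_ta \<circ> racah_ta) (fgen g) = fgen g" for g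
    by (cases g) (simp_all add: ta_gen ta_simps)
qed
lemma st2: "(racah_sg \<circ> racah_ta) \<circ> (racah_sg \<circ> racah_ta) = id"
proof (rule fhom_id)
  show "is_hom ((racah_sg \<circ> racah_ta) \<circ> (racah_sg \<circ> racah_ta))" by (intro fanti_comp fanti_ta fanti_sg)
  show "((racah_sg \<circ> racah_ta) \<circ> (racah_sg \<circ> racah_ta)) (fgen g) = fgen g" for g
    by (cases g) (simp_all add: ta_gen ta_simps sg_gen sg_simps)
qed

lemma d6_relations_pointwise: "racah_sg (racah_sg x) = x" "racah_ta (racah_ta (racah_ta (racah_ta (racah_ta (racah_ta x))))) = x" "racah_sg (racah_ta (racah_sg (racah_ta x))) = x"
  using fun_cong[OF sg2, of x] fun_cong[OF ta6, of x] fun_cong[OF st2, of x] by simp_all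

fun d6_act1 where "d6_act1 (Sigma, b) = racah_sg" | "d6_act1 (Tau, True) = racah_ta" | "d6_act1 (Tau, False) = racah_ta \<circ> racah_ta \<circ> racah_ta \<circ> racah_ta \<circ> racah_ta"
definition d6_act where "d6_act u = foldr (\<lambda>x f. d6_act1 x \<circ> f) u id"

lemma act_append: "d6_act (u @ v) = d6_act u \<circ> d6_act v"
  by (induction u) (auto simp: d6_act_def comp_assoc)
lemma act_Cons: "d6_act (x # u) = d6_act1 x \<circ> d6_act u" by (simp add: d6_act_def)
lemma act_Nil: "d6_act [] = id" by (simp add: d6_act_def)

lemma act_equiv: "word_equiv d6_relators u v \<Longrightarrow> d6_act u = d6_act v"
proof (induction rule: word_equiv.induct)
  case (cancel g b)
  then show ?case by (cases g; cases b) (simp_all add: act_Cons act_Nil fun_eq_iff d6_relations_pointwise)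
next
  case (relator r)
  then show ?case unfolding d6_relators_def
    by (auto simp: act_Cons act_Nil fun_eq_iff d6_relations_pointwise numeral_eq_Suc)
qed (auto simp: act_append)

abbreviation (input) "racah_ideal \<equiv> relator_ideal racah_relators"

lemma anti_pres:
  assumes f: "is_antihom f" and r: "\<And>r. r \<in> racah_relators \<Longrightarrow> f r \<in> racah_ideal" and x: "x \<in> racah_ideal"
  shows "f x \<in> racah_ideal"
proof -
  have "racah_ideal \<subseteq> {x. f x \<in> racah_ideal}"
    by (rule rel_ideal_least) (use r in \<open>auto simp: fanti_simps[OF f] intro: rel_ideal_simps\<close>)
  then show ?thesis using x by auto
qed

lemma racah_relations: "commutator fA fB - 2 * fD \<in> racah_ideal" "commutator fB fC - 2 * fD \<in> racah_ideal" "commutator fC fA - 2 * fD \<in> racah_ideal"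
  "commutator falpha x \<in> racah_ideal" "commutator fbeta x \<in> racah_ideal" "commutator fgamma x \<in> racah_ideal"
  by (auto intro!: rel_ideal_simps(1) simp: racah_relators_def)

lemma anti_comm: "is_antihom f \<Longrightarrow> f (commutator x y) = - commutator (f x) (f y)"
  by (simp add: commutator_def fanti_simps)

lemma sg_greek: "racah_sg falpha = - fbeta" "racah_sg fbeta = - falpha" "racah_sg fgamma = - fgamma" "racah_sg fdelta = fdelta"
  by (simp_all add: falpha_def fbeta_def fgamma_def fdelta_def sg_simps sg_gen commutator_def algebra_simps)

lemma ta_greek: "racah_ta falpha - fbeta \<in> racah_ideal" "racah_ta fbeta - fgamma \<in> racah_ideal" "racah_ta fgamma - falpha \<in> racah_ideal" "racah_ta fdelta = fdelta"
proof -
  have "racah_ta falpha - fbeta = (commutator fA fB - 2 * fD) - (commutator fB fC - 2 * fD)"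
    by (simp add: falpha_def fbeta_def ta_simps ta_gen commutator_def algebra_simps)
  then show "racah_ta falpha - fbeta \<in> racah_ideal" by (metis rel_ideal_simps(5) racah_relations)
  have "racah_ta fbeta - fgamma = (commutator fB fC - 2 * fD) - (commutator fC fA - 2 * fD)"
    by (simp add: fgamma_def fbeta_def ta_simps ta_gen commutator_def algebra_simps)
  then show "racah_ta fbeta - fgamma \<in> racah_ideal" by (metis rel_ideal_simps(5) racah_relations)
  have "racah_ta fgamma - falpha = (commutator fC fA - 2 * fD) - (commutator fA fB - 2 * fD)"
    by (simp add: fgamma_def falpha_def ta_simps ta_gen commutator_def algebra_simps)
  then show "racah_ta fgamma - falpha \<in> racah_ideal" by (metis rel_ideal_simps(5) racah_relations)
  show "racah_ta fdelta = fdelta" by (simp add: fdelta_def ta_simps ta_gen algebra_simps)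
qed

lemma comm_cong: assumes "z - w \<in> racah_ideal" "commutator w x \<in> racah_ideal" shows "commutator z x \<in> racah_ideal"
proof -
  have "commutator z x = commutator w x + ((z - w) * x - x * (z - w))" by (simp add: commutator_def algebra_simps)
  then show ?thesis using assms by (metis rel_ideal_simps(3,5,6,7))
qed

lemma uminus_RI: "- x \<in> racah_ideal \<longleftrightarrow> x \<in> racah_ideal" using rel_ideal_simps(4)[of x racah_relators] rel_ideal_simps(4)[of "-x" racah_relators] by auto

lemma commutator_uminus: "commutator (-x) y = - commutator x y" "commutator x (-y) = - commutator x y"
  by (auto simp: commutator_def)
lemma racah_cases:
  assumes "r \<in> racah_relators"
  obtains "r = commutator fA fB - 2 * fD" | "r = commutator fB fC - 2 * fD" | "r = commutator fC fA - 2 * fD"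
    | x where "r = commutator falpha x" | x where "r = commutator fbeta x" | x where "r = commutator fgamma x"
  using assms unfolding racah_relators_def by blast

lemma sg_RI: "x \<in> racah_ideal \<Longrightarrow> racah_sg x \<in> racah_ideal"
proof (erule anti_pres[OF fanti_sg, rotated])
  fix r :: "(racah_gen, 'a) free_algebra" assume r: "r \<in> racah_relators"
  have e: "racah_sg (commutator fA fB - 2 * fD) = commutator fA fB - 2 * fD"
     "racah_sg (commutator fB fC - 2 * fD) = commutator fC fA - 2 * fD"
     "racah_sg (commutator fC fA - 2 * fD) = commutator fB fC - 2 * fD"
    by (auto simp: sg_simps commutator_def sg_gen algebra_simps mult_2 mult_2_right)
  show "racah_sg r \<in> racah_ideal" using r
    by (cases r rule: racah_cases; simp only: e racah_relations anti_comm[OF fanti_sg] sg_greek commutator_uminus racah_relations uminus_RI)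
qed

lemma ta_RI: "x \<in> racah_ideal \<Longrightarrow> racah_ta x \<in> racah_ideal"
proof (erule anti_pres[OF fanti_ta, rotated])
  fix r :: "(racah_gen, 'a) free_algebra" assume r: "r \<in> racah_relators"
  have e: "racah_ta (commutator fA fB - 2 * fD) = - (commutator fB fC - 2 * fD)"
     "racah_ta (commutator fB fC - 2 * fD) = - (commutator fC fA - 2 * fD)"
     "racah_ta (commutator fC fA - 2 * fD) = - (commutator fA fB - 2 * fD)"
    by (auto simp: ta_simps commutator_def ta_gen algebra_simps mult_2 mult_2_right)
  have "commutator (racah_ta falpha) (racah_ta x) \<in> racah_ideal" "commutator (racah_ta fbeta) (racah_ta x) \<in> racah_ideal" "commutator (racah_ta fgamma) (racah_ta x) \<in> racah_ideal" for x :: "(racah_gen, 'a) free_algebra"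
    using ta_greek by (auto intro: comm_cong racah_relations)
  note tz = this
  show "racah_ta r \<in> racah_ideal" using r
    by (cases r rule: racah_cases; simp only: e racah_relations anti_comm[OF fanti_ta] tz racah_relations uminus_RI)
qed

lemma act1_pres: "is_antihom (d6_act1 a)" "x \<in> racah_ideal \<Longrightarrow> d6_act1 a x \<in> racah_ideal"
proof -
  show "is_antihom (d6_act1 a)"
  proof (cases a rule: d6_act1.cases)
    case 3
    have "is_antihom ((racah_ta \<circ> racah_ta) \<circ> ((racah_ta \<circ> racah_ta) \<circ> racah_ta))" by (intro fanti_comp fanti_ta)
    then show ?thesis using 3 by (simp add: comp_assoc)
  qed (auto simp: fanti_sg fanti_ta)
  show "x \<in> racah_ideal \<Longrightarrow> d6_act1 a x \<in> racah_ideal"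
    by (cases a rule: d6_act1.cases) (auto simp: sg_RI ta_RI)
qed

lemma act_pres: "is_antihom (d6_act u :: (racah_gen,'k::field) free_algebra \<Rightarrow> _) \<or> is_hom (d6_act u :: (racah_gen,'k) free_algebra \<Rightarrow> _)" "x \<in> racah_ideal \<Longrightarrow> d6_act u x \<in> racah_ideal"
proof -
  show "is_antihom (d6_act u :: (racah_gen,'k::field) free_algebra \<Rightarrow> _) \<or> is_hom (d6_act u :: (racah_gen,'k) free_algebra \<Rightarrow> _)"
  proof (induction u)
    case Nil then show ?case by (simp add: act_Nil is_hom_def)
  next
    case (Cons a u) then show ?case unfolding act_Cons
      by (elim disjE; simp only: fanti_comp(1,2)[OF act1_pres(1)] simp_thms)
  qed
  show "x \<in> racah_ideal \<Longrightarrow> d6_act u x \<in> racah_ideal" by (induction u) (auto simp: act_Nil act_Cons intro: act1_pres)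
qed

lemma act_diff: "d6_act u x - d6_act u y = d6_act u (x - y)"
proof -
  have "d6_act u (a + b) = d6_act u a + d6_act u b" for a b using act_pres(1)[of u] by (auto simp: is_antihom_def is_hom_def)
  from this[of "x - y" y] show ?thesis by simp
qed

subsection \<open>The action on the quotient\<close>

definition racah_lift :: "((racah_gen,'k::field) free_algebra \<Rightarrow> (racah_gen,'k) free_algebra) \<Rightarrow> (racah_gen,'k) free_algebra set \<Rightarrow> (racah_gen,'k) free_algebra set" where "racah_lift f = (\<lambda>X\<in>carrier racah. racah_class (f (SOME x. X = racah_class x)))"

lemma carrier_racah: "carrier racah = range racah_class" by (simp add: racah_def pa_simps)

lemma racah_lift: assumes "\<And>x y. x - y \<in> racah_ideal \<Longrightarrow> f x - f y \<in> racah_ideal" shows "racah_lift f (racah_class x) = racah_class (f x)"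
proof -
  have "racah_class x = racah_class (SOME y. racah_class x = racah_class y)" by (rule someI) simp
  then have "racah_class (f x) = racah_class (f (SOME y. racah_class x = racah_class y))"
    using assms unfolding rc_eq by blast
  then show ?thesis by (simp add: racah_lift_def carrier_racah)
qed

lemma racah_lift_act: "racah_lift (d6_act u) (racah_class x) = racah_class (d6_act u x)"
  by (rule racah_lift) (simp add: act_diff act_pres)

lemma lact_ext: "racah_lift f \<in> extensional (carrier racah)" by (simp add: racah_lift_def)

lemma lact_comp: "compose (carrier racah) (racah_lift (d6_act u)) (racah_lift (d6_act v)) = racah_lift (d6_act (u @ v))"
proof (rule extensionalityI[of _ "carrier racah"])
  fix X :: "(racah_gen, 'a) free_algebra set" assume "X \<in> carrier racah"
  then obtain x where x: "X = racah_class x" by (auto simp: carrier_racah)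
  show "compose (carrier racah) (racah_lift (d6_act u)) (racah_lift (d6_act v)) X = racah_lift (d6_act (u @ v)) X"
    unfolding x racah_lift_act by (simp add: compose_def carrier_racah racah_lift_act act_append)
qed (auto simp: lact_ext)

lemma winv_act: "d6_act (word_inverse u @ u) = id" "d6_act (u @ word_inverse u) = id"
proof -
  show *: "d6_act (word_inverse u @ u) = id" for u using act_equiv[OF word_inverse[of d6_relators u]] by (simp add: act_Nil)
  have "word_inverse (word_inverse u) = u" by (simp add: word_inverse_def rev_map comp_def split_def)
  then show "d6_act (u @ word_inverse u) = id" using *[of "word_inverse u"] by simp
qed

lemma winv_pt: "d6_act (word_inverse u) (d6_act u x) = x" "d6_act u (d6_act (word_inverse u) x) = x"
  using fun_cong[OF winv_act(1)[of u], of x] fun_cong[OF winv_act(2)[of u], of x] by (simp_all add: act_append)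

lemma lact_Bij: "racah_lift (d6_act u) \<in> Bij (carrier racah)"
proof -
  have "bij_betw (racah_lift (d6_act u)) (carrier racah) (carrier racah)"
    by (rule bij_betwI[where g="racah_lift (d6_act (word_inverse u))"])
      (auto simp: carrier_racah racah_lift_act winv_pt)
  then show ?thesis by (simp add: Bij_def lact_ext)
qed

definition racah_rep :: "dihedral_gen group_word set \<Rightarrow> (racah_gen,'k::field) free_algebra set \<Rightarrow> (racah_gen,'k) free_algebra set" where "racah_rep = (\<lambda>X\<in>carrier D6. racah_lift (d6_act (SOME u. X = word_class d6_relators u)))"

lemma racah_rep: "racah_rep (word_class d6_relators u) = (racah_lift (d6_act u) :: (racah_gen,'a::field) free_algebra set \<Rightarrow> _)"
proof -
  have "word_class d6_relators u = word_class d6_relators (SOME v. word_class d6_relators u = word_class d6_relators v)" by (rule someI) simp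
  then have "(d6_act u :: (racah_gen,'a) free_algebra \<Rightarrow> _) = d6_act (SOME v. word_class d6_relators u = word_class d6_relators v)"
    using act_equiv unfolding wc_eq by blast
  then show ?thesis by (simp add: racah_rep_def D6_def pg_simps)
qed

lemma phi_action: "group_action D6 (carrier racah) racah_rep"
proof (unfold group_action_def, rule group_hom.intro)
  show "group D6" by (simp add: D6_def pg_group)
  show "group (BijGroup (carrier racah))" by (rule group_BijGroup)
  show "group_hom_axioms D6 (BijGroup (carrier racah)) racah_rep"
    by (rule group_hom_axioms.intro, rule homI)
     (auto simp: D6_def pg_simps racah_rep lact_Bij BijGroup_def lact_comp)
qed

lemma lact_bij: "bij_betw (racah_lift (d6_act u)) (carrier racah) (carrier racah)"
  using lact_Bij by (auto simp: Bij_def)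

lemma racah_ops: "racah_class x \<oplus>\<^bsub>racah\<^esub> racah_class y = racah_class (x + y)"
   "racah_class x \<otimes>\<^bsub>racah\<^esub> racah_class y = racah_class (x * y)"
   "\<one>\<^bsub>racah\<^esub> = racah_class 1" "c \<odot>\<^bsub>racah\<^esub> racah_class x = racah_class (fscalar c * x)"
  by (simp_all add: racah_def pa_simps)

lemma anti_lact:
  fixes u
  defines "f \<equiv> (d6_act u :: (racah_gen,'k::field) free_algebra \<Rightarrow> _)"
  assumes "is_antihom f" shows "algebra_antiautomorphism racah (racah_lift f)"
  unfolding algebra_antiautomorphism_def
proof (intro conjI)
  show "bij_betw (racah_lift f) (carrier racah) (carrier racah)" unfolding f_def by (rule lact_bij)
  have lf: "racah_lift f (racah_class x) = racah_class (f x)" for x unfolding f_def by (rule racah_lift_act)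
  note l = fanti_simps[OF assms(2)]
  show "\<forall>x\<in>carrier racah. \<forall>y\<in>carrier racah. racah_lift f (x \<oplus>\<^bsub>racah\<^esub> y) = racah_lift f x \<oplus>\<^bsub>racah\<^esub> racah_lift f y"
    by (clarsimp simp: carrier_racah lf racah_ops l)
  show "\<forall>x\<in>carrier racah. \<forall>y\<in>carrier racah. racah_lift f (x \<otimes>\<^bsub>racah\<^esub> y) = racah_lift f y \<otimes>\<^bsub>racah\<^esub> racah_lift f x"
    by (clarsimp simp: carrier_racah lf racah_ops l)
  show "racah_lift f \<one>\<^bsub>racah\<^esub> = \<one>\<^bsub>racah\<^esub>"
    by (simp add: racah_ops lf l)
  show "\<forall>c. \<forall>x\<in>carrier racah. racah_lift f (c \<odot>\<^bsub>racah\<^esub> x) = c \<odot>\<^bsub>racah\<^esub> racah_lift f x"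
    by (clarsimp simp: carrier_racah lf racah_ops l fscalar_comm[symmetric])
qed

lemma racah_class_eq: "racah_class x = racah_class y \<longleftrightarrow> x - y \<in> racah_ideal" by (rule rc_eq)

lemma act_sg: "d6_act [(Sigma,True)] = racah_sg" "d6_act [(Tau,True)] = racah_ta" by (auto simp: act_Cons act_Nil)

lemma lft_gen: "racah_lift racah_sg (racah_class x) = racah_class (racah_sg x)" "racah_lift racah_ta (racah_class x) = racah_class (racah_ta x)"
  using racah_lift_act[of "[(Sigma,True)]" x] racah_lift_act[of "[(Tau,True)]" x] by (simp_all add: act_sg)

lemma is_racah_D6_action_rep: "is_racah_D6_action racah_rep"
  unfolding is_racah_D6_action_def
proof (intro conjI)
  show "group_action D6 (carrier racah) racah_rep" by (rule phi_action)
  show "algebra_antiautomorphism racah (racah_rep d6_sigma)" "algebra_antiautomorphism racah (racah_rep d6_tau)"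
    by (simp_all only: d6_sigma_def d6_tau_def racah_rep) (rule anti_lact, simp add: act_sg fanti_sg fanti_ta)+
  show "racah_rep \<in> extensional (carrier D6)" by (simp add: racah_rep_def)
qed (auto simp: d6_sigma_def d6_tau_def racah_rep rA_def rB_def rC_def rD_def ralpha_def rbeta_def rgamma_def rdelta_def
    lft_gen act_sg sg_gen ta_gen sg_greek racah_def pa_uminus ta_greek[unfolded racah_class_eq[symmetric]])

lemma anti_unique:
  assumes "algebra_antiautomorphism racah f" "algebra_antiautomorphism racah g"
   "f rA = g rA" "f rB = g rB" "f rC = g rC" "f rD = g rD"
  shows "f (racah_class x) = g (racah_class x)"
proof (induction x rule: fa_gen_induct)
  case (scalar c)
  have "racah_class (fscalar c) = c \<odot>\<^bsub>racah\<^esub> \<one>\<^bsub>racah\<^esub>" by (simp add: racah_def pa_simps)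
  moreover have "\<one>\<^bsub>racah\<^esub> \<in> carrier (racah :: ('a, (racah_gen,'a) free_algebra set) module)" by (simp add: racah_def pa_simps)
  ultimately show ?case using assms by (simp add: algebra_antiautomorphism_def)
next
  case (gen h)
  show ?case using assms by (cases h) (auto simp: rA_def rB_def rC_def rD_def)
next
  case (plus p q)
  have "racah_class (p + q) = racah_class p \<oplus>\<^bsub>racah\<^esub> racah_class q" by (simp add: racah_def pa_simps)
  moreover have "racah_class p \<in> carrier racah" "racah_class q \<in> carrier racah" by (auto simp: carrier_racah)
  ultimately show ?case using assms plus by (simp add: algebra_antiautomorphism_def)
next
  case (mult p q)
  have "racah_class (p * q) = racah_class p \<otimes>\<^bsub>racah\<^esub> racah_class q" by (simp add: racah_def pa_simps)
  moreover have "racah_class p \<in> carrier racah" "racah_class q \<in> carrier racah" by (auto simp: carrier_racah)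
  ultimately show ?case using assms mult by (simp add: algebra_antiautomorphism_def)
qed

lemma racah_D6_action_unique:
  assumes a: "is_racah_D6_action \<phi>" and b: "is_racah_D6_action \<psi>"
  shows "\<phi> = \<psi>"
proof -
  interpret p: group_hom D6 "BijGroup (carrier racah)" \<phi> using a by (auto simp: is_racah_D6_action_def group_action_def)
  interpret q: group_hom D6 "BijGroup (carrier racah)" \<psi> using b by (auto simp: is_racah_D6_action_def group_action_def)
  let ?w = "word_class d6_relators"
  have car6: "?w u \<in> carrier D6" for u by (simp add: D6_def pg_simps)
  have ext: "\<phi> (?w u) \<in> extensional (carrier racah)" "\<psi> (?w u) \<in> extensional (carrier racah)" for u
    using p.hom_closed[OF car6] q.hom_closed[OF car6] by (auto simp: BijGroup_def Bij_def)
  have gen: "\<phi> (?w [(g,True)]) = \<psi> (?w [(g,True)])" for g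
  proof (rule extensionalityI[OF ext])
    fix X :: "(racah_gen, 'a) free_algebra set" assume "X \<in> carrier racah"
    then obtain x where x: "X = racah_class x" by (auto simp: carrier_racah)
    show "\<phi> (?w [(g,True)]) X = \<psi> (?w [(g,True)]) X" unfolding x
      by (rule anti_unique[where f="\<phi> (?w [(g,True)])" and g="\<psi> (?w [(g,True)])"]; cases g)
        (use a b in \<open>simp_all only: is_racah_D6_action_def d6_sigma_def d6_tau_def\<close>)
  qed
  have inv: "?w [(g,False)] = inv\<^bsub>D6\<^esub> (?w [(g,True)])" for g
    by (rule p.G.inv_equality[symmetric]) 
       (use word_equiv.cancel[of d6_relators g False] in \<open>auto simp: D6_def pg_simps wc_eq\<close>)
  have one: "\<phi> (?w [(g,b)]) = \<psi> (?w [(g,b)])" for g b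
    using gen by (cases b) (auto simp: inv car6 p.hom_inv q.hom_inv)
  have nil: "?w [] = \<one>\<^bsub>D6\<^esub>" by (simp add: D6_def pg_simps)
  have cons: "?w (a # u) = ?w [a] \<otimes>\<^bsub>D6\<^esub> ?w u" for a u by (simp add: D6_def pg_simps)
  have "\<phi> (?w u) = \<psi> (?w u)" for u
  proof (induction u)
    case Nil show ?case unfolding nil by simp
  next
    case (Cons a u) then show ?case unfolding cons[of a u] using one by (cases a) (simp add: car6)
  qed
  then show ?thesis using a b
    by (intro extensionalityI[of _ "carrier D6"]) (auto simp: is_racah_D6_action_def D6_def pg_simps)
qed

lemma racah_D6_action_ex1: "\<exists>!\<phi>. is_racah_D6_action (\<phi> :: _ \<Rightarrow> (racah_gen,'k::field) free_algebra set \<Rightarrow> _)"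
  by (rule ex1I[of _ racah_rep], rule is_racah_D6_action_rep, rule racah_D6_action_unique[OF _ is_racah_D6_action_rep])

lemma is_racah_D6_action_racah_D6_action: "is_racah_D6_action racah_D6_action"
  unfolding racah_D6_action_def by (rule theI'[OF racah_D6_action_ex1])

end

theory Submission
  imports Defs
begin

text \<open>
  By the relations of \<open>D6\<close>, each of its elements has the form \<open>\<sigma>\<^sup>a \<tau>\<^sup>i\<close> with \<open>a < 2\<close> and \<open>i < 6\<close>, and
  the nontrivial ones either permute the generators \<open>A, B, C\<close> nontrivially or send \<open>D\<close> to \<open>-D\<close>.
  So it is enough that \<open>A, B, C\<close> are distinct in \<open>\<Re>\<close> and \<open>D \<noteq> -D\<close>, which is visible in the
  two-dimensional representation \<open>A = E\<^sub>1\<^sub>2\<close>, \<open>B = E\<^sub>2\<^sub>1\<close>, \<open>C = 1 - A - B\<close>, \<open>D = [A,B]/2\<close>, where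
  \<open>\<alpha> = -1\<close>, \<open>\<beta> = 1\<close> and \<open>\<gamma> = 0\<close>.
\<close>

section \<open>Homomorphisms out of a free algebra\<close>

text \<open>The target is a bare ring; the central ring map \<open>s\<close> from the field makes it
  an algebra.\<close>

locale free_algebra_hom =
  fixes s :: "'k::field \<Rightarrow> 'a::ring_1" and h :: "'g \<Rightarrow> 'a"
  assumes s_add: "s (c + d) = s c + s d"
    and s_mult: "s (c * d) = s c * s d"
    and s_1: "s 1 = 1"
    and s_central: "s c * x = x * s c"
begin

definition hom_extension :: "('g, 'k) free_algebra \<Rightarrow> 'a"
  where "hom_extension p =
    (\<Sum>w\<in>Poly_Mapping.keys p. s (Poly_Mapping.lookup p w) * prod_list (map h (letters w)))"

lemma s_0: "s 0 = 0"
  using s_add[of 0 0] by simp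

text \<open>Lets the sums for \<open>p\<close>, \<open>q\<close> and \<open>p + q\<close>, whose
  supports differ, run over one index set.\<close>

lemma hom_extension_superset:
  assumes "finite S" "Poly_Mapping.keys p \<subseteq> S"
  shows "hom_extension p =
    (\<Sum>w\<in>S. s (Poly_Mapping.lookup p w) * prod_list (map h (letters w)))"
  unfolding hom_extension_def using assms
  by (intro sum.mono_neutral_left) (auto simp: not_in_keys_iff_lookup_eq_zero s_0)

lemma hom_extension_add: "hom_extension (p + q) = hom_extension p + hom_extension q"
proof -
  let ?S = "Poly_Mapping.keys p \<union> Poly_Mapping.keys q"
  have "hom_extension r =
      (\<Sum>w\<in>?S. s (Poly_Mapping.lookup r w) * prod_list (map h (letters w)))"
    if "Poly_Mapping.keys r \<subseteq> ?S" for r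
    by (rule hom_extension_superset) (use that in auto)
  moreover have "Poly_Mapping.keys (p + q) \<subseteq> ?S"
    by (rule keys_add)
  ultimately show ?thesis
    by (simp add: lookup_add s_add distrib_right sum.distrib)
qed

lemma hom_extension_single:
  "hom_extension (Poly_Mapping.single w c) = s c * prod_list (map h (letters w))"
  by (subst hom_extension_superset[where S = "{w}"]) auto

text \<open>Both sides are additive in each argument, so single terms suffice; there
  \<open>s_central\<close> carries the scalar of the second factor past the word of the
  first.\<close>

lemma hom_extension_mult: "hom_extension (p * q) = hom_extension p * hom_extension q"
proof (induction p rule: fa_induct)
  case (single w c)
  show ?case
  proof (induction q rule: fa_induct)
    case (single v d)
    let ?w = "prod_list (map h (letters w))" and ?v = "prod_list (map h (letters v))"
    have "s (c * d) * (?w * ?v) = s c * (s d * ?w) * ?v"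
      by (simp only: s_mult mult.assoc)
    also have "\<dots> = (s c * ?w) * (s d * ?v)"
      by (simp only: s_central[of d ?w] mult.assoc)
    finally show ?case
      by (simp add: mult_single hom_extension_single plus_word_def)
  qed (simp add: hom_extension_add distrib_left)
qed (simp add: hom_extension_add distrib_right)

lemma hom_extension_fgen: "hom_extension (fgen g) = h g"
  by (simp add: fgen_def hom_extension_single s_1)

lemma hom_extension_0: "hom_extension 0 = 0"
  using hom_extension_add[of 0 0] by simp

lemma hom_extension_uminus: "hom_extension (- p) = - hom_extension p"
  using hom_extension_add[of p "- p"] by (simp add: hom_extension_0 eq_neg_iff_add_eq_0 add.commute)

lemma hom_extension_diff: "hom_extension (p - q) = hom_extension p - hom_extension q"
  using hom_extension_add[of p "- q"] by (simp add: hom_extension_uminus)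

text \<open>The kernel is a two-sided ideal containing \<open>R\<close>. This is how a
  representation descends to the presented algebra.\<close>

lemma hom_extension_relator_ideal:
  assumes "\<And>r. r \<in> R \<Longrightarrow> hom_extension r = 0" "x \<in> relator_ideal R"
  shows "hom_extension x = 0"
proof -
  have "relator_ideal R \<subseteq> {x. hom_extension x = 0}"
    by (rule rel_ideal_least)
      (use assms(1) in \<open>auto simp: hom_extension_0 hom_extension_add hom_extension_uminus
        hom_extension_mult\<close>)
  then show ?thesis
    using assms(2) by auto
qed

end

section \<open>A representation of \<Re> by 2 by 2 matrices\<close>

datatype 'a mat2 = Mat2 'a 'a 'a 'a

instantiation mat2 :: (comm_ring_1) ring_1
begin

definition "0 = Mat2 0 0 0 0"

definition "1 = Mat2 1 0 0 1"

fun plus_mat2 where "Mat2 a b c d + Mat2 a' b' c' d' = Mat2 (a + a') (b + b') (c + c') (d + d')"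

fun uminus_mat2 where "- Mat2 a b c d = Mat2 (- a) (- b) (- c) (- d)"

fun minus_mat2 where "Mat2 a b c d - Mat2 a' b' c' d' = Mat2 (a - a') (b - b') (c - c') (d - d')"

fun times_mat2 where
  "Mat2 a b c d * Mat2 a' b' c' d' =
    Mat2 (a * a' + b * c') (a * b' + b * d') (c * a' + d * c') (c * b' + d * d')"

instance
proof
  fix x y z :: "'a mat2"
  show "x + y + z = x + (y + z)" "x * y * z = x * (y * z)" "(x + y) * z = x * z + y * z"
    "x * (y + z) = x * y + x * z"
    by (cases x; cases y; cases z; simp add: algebra_simps)+
  show "x + y = y + x" "x - y = x + - y"
    by (cases x; cases y; simp)+
  show "0 + x = x" "- x + x = 0" "1 * x = x" "x * 1 = x"
    by (cases x; simp add: zero_mat2_def one_mat2_def)+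
qed (simp add: zero_mat2_def one_mat2_def)

end

text \<open>Kept folded: the matrix computations use only \<open>half + half = 1\<close>.\<close>

definition half :: "'k::field" where "half = 1 / 2"

lemma half_add_half: "(2::'k::field) \<noteq> 0 \<Longrightarrow> half + half = (1::'k)"
  by (simp add: half_def flip: mult_2)

text \<open>Since \<delta> goes to the identity, [A,B], [B,C] and [C,A] have the same image diag(1,
  -1), which is twice the image of D when 2 is invertible.\<close>

fun racah_mat :: "racah_gen \<Rightarrow> 'k::field mat2" where
  "racah_mat GA = Mat2 0 1 0 0"
| "racah_mat GB = Mat2 0 0 1 0"
| "racah_mat GC = Mat2 1 (- 1) (- 1) 1"
| "racah_mat GD = Mat2 half 0 0 (- half)"

interpretation racah_hom: free_algebra_hom "\<lambda>c::'k::field. Mat2 c 0 0 c" racah_mat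
proof
  fix c :: 'k and x :: "'k mat2"
  show "Mat2 c 0 0 c * x = x * Mat2 c 0 0 c"
    by (cases x) (simp add: algebra_simps)
qed (auto simp: one_mat2_def)

lemmas racah_hom_simps = racah_hom.hom_extension_add racah_hom.hom_extension_diff
  racah_hom.hom_extension_mult racah_hom.hom_extension_uminus racah_hom.hom_extension_fgen

lemma racah_hom_racah_ideal:
  assumes "(2::'k::field) \<noteq> 0" "x \<in> relator_ideal (racah_relators :: (racah_gen, 'k) free_algebra set)"
  shows "racah_hom.hom_extension x = 0"
proof (rule racah_hom.hom_extension_relator_ideal[OF _ assms(2)])
  fix r :: "(racah_gen, 'k) free_algebra"
  assume "r \<in> racah_relators"
  note defs = commutator_def falpha_def fbeta_def fgamma_def mult_2 racah_hom_simps
  have half: "half + half = (1::'k)" "half + (half + x) = 1 + x" for x :: 'k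
    using half_add_half[OF assms(1)] by (simp_all flip: add.assoc)
  have neg_half: "- half - half = (- 1 :: 'k)"
    using half(1) by (simp flip: minus_add_distrib)
  have greek: "racah_hom.hom_extension falpha = Mat2 (- 1) 0 0 (- 1 :: 'k)"
    "racah_hom.hom_extension fbeta = Mat2 1 0 0 (1 :: 'k)"
    "racah_hom.hom_extension fgamma = Mat2 0 0 0 (0 :: 'k)"
    by (simp_all add: defs half neg_half zero_mat2_def)
  from \<open>r \<in> racah_relators\<close> show "racah_hom.hom_extension r = 0"
  proof (cases r rule: racah_cases)
    case 1 then show ?thesis by (simp add: defs half zero_mat2_def)
  next
    case 2 then show ?thesis by (simp add: defs half zero_mat2_def)
  next
    case 3 then show ?thesis by (simp add: defs half zero_mat2_def)
  next
    \<comment> \<open>\<alpha>, \<beta>, \<gamma> have scalar images, which commute with every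
      matrix; splitting the image of \<open>x\<close> into entries makes this visible.\<close>
    case (4 x)
    then show ?thesis
      by (cases "racah_hom.hom_extension x")
        (simp add: commutator_def racah_hom_simps greek zero_mat2_def)
  next
    case (5 x)
    then show ?thesis
      by (cases "racah_hom.hom_extension x")
        (simp add: commutator_def racah_hom_simps greek zero_mat2_def)
  next
    case (6 x)
    then show ?thesis
      by (cases "racah_hom.hom_extension x")
        (simp add: commutator_def racah_hom_simps greek zero_mat2_def)
  qed
qed

section \<open>Normal forms in the dihedral group\<close>

lemma word_equiv_delete:
  assumes "word_equiv R r []"
  shows "word_equiv R (u @ r @ v) (u @ v)"
  using word_equiv.append[OF word_equiv.refl[of R u]
      word_equiv.append[OF assms word_equiv.refl[of R v]]] by simp

abbreviation d6_equiv (infix "\<approx>" 50) where "d6_equiv \<equiv> word_equiv d6_relators"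

abbreviation "S \<equiv> (Sigma, True)"
abbreviation "T \<equiv> (Tau, True)"

lemma sigma_square: "[S, S] \<approx> []"
  and tau_pow6: "replicate 6 T \<approx> []"
  and sigma_tau_square: "[S, T, S, T] \<approx> []"
  by (rule word_equiv.relator; simp add: d6_relators_def numeral_2_eq_2)+

text \<open>The rule that moves \<sigma> to the left of \<tau>, with \<tau>^5 in place of the
  inverse of \<tau>.\<close>

lemma tau_sigma: "[T, S] \<approx> S # replicate 5 T"
proof -
  \<comment> \<open>Deleting \<tau>^6 and then \<sigma>\<sigma> leaves \<tau>\<sigma>; deleting the
    inner \<sigma>\<tau>\<sigma>\<tau>, which uses up one of the six final \<tau>, leaves
    \<sigma>\<tau>^5.\<close>
  let ?w = "[S, S, T, S] @ replicate 6 T"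
  have delete: "?w \<approx> [S, S] @ [T, S]" "[S, S] @ [T, S] \<approx> [T, S]"
    using word_equiv_delete[OF tau_pow6, of "[S, S, T, S]" "[]"]
      word_equiv_delete[OF sigma_square, of "[]" "[T, S]"] by simp_all
  have "?w \<approx> S # replicate 5 T"
    using word_equiv_delete[OF sigma_tau_square, of "[S]" "replicate 5 T"]
    by (simp add: numeral_eq_Suc)
  then show ?thesis
    by (rule word_equiv.trans[OF word_equiv.sym[OF word_equiv.trans[OF delete]]])
qed

text \<open>Insert the trivial power after the inverse letter, then cancel that letter against the
  first copy of \<open>g\<close>.\<close>

lemma inverse_letter:
  assumes "replicate (Suc n) (g, True) \<approx> []"
  shows "[(g, False)] \<approx> replicate n (g, True)"
proof -
  have "[(g, False)] @ replicate (Suc n) (g, True) \<approx> [(g, False)]"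
    using word_equiv_delete[OF assms, of "[(g, False)]" "[]"] by simp
  then have "[(g, False)] \<approx> [(g, False)] @ replicate (Suc n) (g, True)"
    by (rule word_equiv.sym)
  also have "\<dots> \<approx> replicate n (g, True)"
    using word_equiv_delete[OF word_equiv.cancel[of d6_relators g False], of "[]"] by simp
  finally (word_equiv.trans) show ?thesis .
qed

lemma tau_pow_mod: "replicate i T \<approx> replicate (i mod 6) T"
proof (induction i rule: less_induct)
  case (less i)
  show ?case
  proof (cases "i < 6")
    case True
    then show ?thesis by (simp add: word_equiv.refl)
  next
    case False
    then have "replicate i T = replicate 6 T @ replicate (i - 6) T"
      by (simp flip: replicate_add)
    then have "replicate i T \<approx> replicate (i - 6) T"
      using word_equiv_delete[OF tau_pow6, of "[]" "replicate (i - 6) T"] by simp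
    then show ?thesis
      using less[of "i - 6"] False word_equiv.trans by (fastforce simp: le_mod_geq)
  qed
qed

text \<open>By induction on the word: prepending \<sigma> or \<tau> preserves the form, and an
  inverse letter is first rewritten as a positive power.\<close>

lemma d6_normal_form: "\<exists>a<2. \<exists>i<6. u \<approx> replicate a S @ replicate i T"
proof -
  \<comment> \<open>The exponent of \<tau> stays unbounded during the induction and is reduced
    modulo 6 only at the end.\<close>
  let ?nf = "\<lambda>u. \<exists>a<2. \<exists>i. u \<approx> replicate a S @ replicate i T"
  have cons: "x # u \<approx> x # v" if "u \<approx> v" for x u v
    using word_equiv.append[OF word_equiv.refl[of _ "[x]"] that] by simp
  have S: "?nf (S # u)" if nf: "?nf u" for u
  proof -
    obtain a i where a: "a < 2" and u: "u \<approx> replicate a S @ replicate i T"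
      using nf by blast
    show ?thesis
    proof (cases "a = 0")
      case True
      then show ?thesis using cons[OF u, of S] by (intro exI[of _ 1]) auto
    next
      case False
      with a have "a = 1" by simp
      then have "S # u \<approx> replicate i T"
        using word_equiv.trans[OF cons[OF u, of S]]
          word_equiv_delete[OF sigma_square, of "[]" "replicate i T"] by simp
      then show ?thesis by (intro exI[of _ 0]) auto
    qed
  qed
  have T: "?nf (T # u)" if nf: "?nf u" for u
  proof -
    obtain a i where a: "a < 2" and u: "u \<approx> replicate a S @ replicate i T"
      using nf by blast
    show ?thesis
    proof (cases "a = 0")
      case True
      then have "T # u \<approx> replicate (Suc i) T" using cons[OF u, of T] by simp
      then show ?thesis by (intro exI[of _ 0]) (auto simp del: replicate_Suc)
    next
      case False
      with a have "a = 1" by simp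
      then have "T # u \<approx> [T, S] @ replicate i T"
        using cons[OF u, of T] by simp
      moreover have "[T, S] @ replicate i T \<approx> (S # replicate 5 T) @ replicate i T"
        by (intro word_equiv.append tau_sigma word_equiv.refl)
      ultimately have "T # u \<approx> replicate 1 S @ replicate (5 + i) T"
        using word_equiv.trans by (fastforce simp: replicate_add)
      then show ?thesis by (intro exI[of _ 1]) auto
    qed
  qed
  have "?nf u"
  proof (induction u)
    case Nil
    show ?case by (intro exI[of _ 0]) (auto intro!: exI[of _ 0] word_equiv.refl)
  next
    case (Cons x u)
    have pos: "?nf (replicate n (g, True) @ u)" for n g
      using Cons by (induction n) (cases g; simp add: S T)+
    \<comment> \<open>\<open>n\<close> is 1 for a positive letter and for the inverse of \<sigma>,
      and 5 for the inverse of \<tau>.\<close>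
    obtain n where "[x] \<approx> replicate n (fst x, True)"
    proof (cases x)
      case (Pair g b)
      have "[(Sigma, False)] \<approx> replicate 1 S" "[(Tau, False)] \<approx> replicate 5 T"
        using inverse_letter[of 1 Sigma] inverse_letter[of 5 Tau] sigma_square tau_pow6
        by simp_all
      then show thesis
        using that[of 1] that[of 5] Pair word_equiv.refl by (cases g; cases b) auto
    qed
    then have "[x] @ u \<approx> replicate n (fst x, True) @ u"
      by (rule word_equiv.append) (rule word_equiv.refl)
    then show ?case using pos[of n "fst x"] word_equiv.trans by fastforce
  qed
  then obtain a i where a: "a < 2" and u: "u \<approx> replicate a S @ replicate i T" by blast
  have "u \<approx> replicate a S @ replicate (i mod 6) T"
    using word_equiv.trans[OF u word_equiv.append[OF word_equiv.refl tau_pow_mod]] .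
  moreover have "i mod 6 < 6"
    by simp
  ultimately show ?thesis
    using a by blast
qed

section \<open>Triviality of the kernel\<close>

text \<open>\<tau> negates D and \<sigma> fixes it, so D excludes odd \<open>i\<close>; in
  particular \<tau>^3, which fixes A, B and C, is detected by D alone. For even \<open>i\<close> the
  twofold choice of \<open>a\<close> gives the six permutations of A, B, C, and only the trivial one
  fixes both A and B.\<close>

lemma racah_mat_act_eq_id:
  assumes two: "(2::'k::field) \<noteq> 0" and "a < 2" "i < 6"
    and id: "\<And>g. racah_hom.hom_extension (d6_act (replicate a S @ replicate i T) (fgen g)) =
      (racah_mat g :: 'k mat2)"
  shows "a = 0 \<and> i = 0"
proof -
  have D: "(- racah_mat GD :: 'k mat2) \<noteq> racah_mat GD"
  proof
    assume "(- racah_mat GD :: 'k mat2) = racah_mat GD"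
    then have "half = - (half :: 'k)"
      unfolding racah_mat.simps uminus_mat2.simps mat2.inject by (rule conjunct1[THEN HOL.sym])
    then have "half + half = (0 :: 'k)"
      by (simp only: eq_neg_iff_add_eq_0)
    with half_add_half[OF two] show False
      by simp
  qed
  have ABC: "racah_mat g = (racah_mat g' :: 'k mat2) \<longleftrightarrow> g = g'"
    if "g \<in> {GA, GB, GC}" "g' \<in> {GA, GB, GC}" for g g'
    using that by auto
  have "a \<in> {0, 1}" "i \<in> {0, 1, 2, 3, 4, 5}"
    using assms(2,3) by auto
  \<comment> \<open>The twelve cases are evaluated with the matrices folded, and \<open>ABC\<close>
    and \<open>D\<close> tell them apart.\<close>
  then show ?thesis
    using id[of GA] id[of GB] id[of GD] D
    by (elim insertE emptyE; simp del: racah_mat.simps add: ABC numeral_eq_Suc act_Cons act_Nil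
        sg_gen ta_gen sg_simps(6) ta_simps(6) racah_hom_simps)
qed

theorem proposition4p3:
  assumes "CHAR('k::field) \<noteq> 2"
  shows "faithful_action D6 (carrier (racah :: ('k, (racah_gen, 'k) free_algebra set) module))
    racah_D6_action"
proof -
  \<comment> \<open>The argument runs on the explicit \<open>racah_rep\<close>, identified with
    \<open>racah_D6_action\<close> by uniqueness at the end.\<close>
  let ?\<phi> = "racah_rep :: _ \<Rightarrow> (racah_gen, 'k) free_algebra set \<Rightarrow> _"
  \<comment> \<open>If 2 = 0, the characteristic divides the prime 2, and it is not 1.\<close>
  have two: "(2::'k) \<noteq> 0"
    using assms of_nat_eq_0_iff_char_dvd[where ?'a = 'k, of 2]
      CHAR_not_1[where ?'a = 'k] prime_nat_iff[of 2] by auto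
  interpret group_hom D6 "BijGroup (carrier (racah :: ('k, (racah_gen, 'k) free_algebra set) module))" ?\<phi>
    using phi_action by (simp add: group_action_def)
  have "inj_on ?\<phi> (carrier D6)"
    unfolding inj_on_one_iff
  proof (intro allI impI)
    fix X assume "X \<in> carrier D6" and X: "?\<phi> X = \<one>\<^bsub>BijGroup (carrier racah)\<^esub>"
    then obtain u where u: "X = word_class d6_relators u"
      by (auto simp: D6_def pg_simps)
    obtain a i where ai: "a < 2" "i < 6" and nf: "u \<approx> replicate a S @ replicate i T"
      using d6_normal_form by blast
    let ?w = "replicate a S @ replicate i T"
    have X_eq: "X = word_class d6_relators ?w"
      using nf u by (simp add: wc_eq)
    have "racah_class (d6_act ?w x) = racah_class x" for x :: "(racah_gen, 'k) free_algebra"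
      using X racah_lift_act[of ?w x] unfolding X_eq racah_rep
      by (simp add: BijGroup_def carrier_racah)
    \<comment> \<open>Elements of the same class differ by an element of the ideal, which the
      representation kills.\<close>
    then have "racah_hom.hom_extension (d6_act ?w x) = racah_hom.hom_extension x"
      for x :: "(racah_gen, 'k) free_algebra"
      using racah_hom_racah_ideal[OF two, of "d6_act ?w x - x"]
      by (simp add: racah_class_eq racah_hom_simps)
    then have "a = 0 \<and> i = 0"
      by (intro racah_mat_act_eq_id[OF two ai]) (simp add: racah_hom_simps)
    then show "X = \<one>\<^bsub>D6\<^esub>"
      using X_eq by (simp add: D6_def pg_simps)
  qed
  moreover have "racah_D6_action = ?\<phi>"
    using racah_D6_action_unique is_racah_D6_action_racah_D6_action is_racah_D6_action_rep by blast
  ultimately show ?thesis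
    using phi_action by (simp add: faithful_action_def faithful_action_axioms_def)
qed

end
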